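(* Let $\mu_L\in ID(\mathbb{R})$ with $\mu_L\neq\delta_0$. Then $\Lambda_{\mu_L}:ID(\mathbb{R}^+)\to ID(\mathbb{R})$ is injective, continuous (for weak convergence), and satisfies $\Lambda_{\mu_L}(\mu^1*\mu^2)=\Lambda_{\mu_L}(\mu^1)*\Lambda_{\mu_L}(\mu^2)$ for all $\mu^1,\mu^2\in ID(\mathbb{R}^+)$; i.e. it is a continuous injective homomorphism of convolution semigroups onto its image. Moreover, $\Lambda_{\mu_L}(ID(\mathbb{R}^+))\subsetneq ID(\mathbb{R})$.
   Context: $ID(\mathbb{R})$: infinitely divisible laws on $\mathbb{R}$; $ID(\mathbb{R}^+)$: those supported on $[0,\infty)$; $*$ is convolution. Let $\mu_L$ have characteristic triplet $(\gamma,b,\nu)$ w.r.t. truncation $x\mathbf 1_{\{|x|\le1\}}$, and $\mu_L^s$ the law with characteristic function $\hat\mu_L^{\,s}$. For $\mu_T\in ID(\mathbb{R}^+)$ with drift $\beta_0\ge0$ and Lévy measure $\rho$ on $(0,\infty)$, $\Lambda_{\mu_L}(\mu_T)$ is the infinitely divisible law with triplet $\bar b=b\beta_0$, $\bar\gamma=\gamma\beta_0+\int_0^\infty\int_{|x|\le1}x\,\mu_L^s(dx)\rho(ds)$, $\bar\nu(dx)=\beta_0\nu(dx)+\int_0^\infty\mu_L^s(dx)\rho(ds)$ on $\mathbb{R}\setminus\{0\}$; equivalently the law of $L_{T_1}$ for a Lévy process $L$ with $L_1\sim\mu_L$ and an independent subordinator $T$ with $T_1\sim\mu_T$. *)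

theory Defs
  imports "HOL-Probability.Probability" "HOL-Probability.Convolution"
begin

fun conv_pow :: "real measure \<Rightarrow> nat \<Rightarrow> real measure" where
  "conv_pow \<nu> 0 = return borel 0"
| "conv_pow \<nu> (Suc n) = convolution \<nu> (conv_pow \<nu> n)"

definition infdiv :: "real measure \<Rightarrow> bool" where
  "infdiv \<mu> \<longleftrightarrow> real_distribution \<mu> \<and>
     (\<forall>n::nat. n \<ge> 1 \<longrightarrow> (\<exists>\<nu>. real_distribution \<nu> \<and> conv_pow \<nu> n = \<mu>))"

definition ID_R :: "real measure set" where
  "ID_R = {\<mu>. infdiv \<mu>}"

definition ID_Rplus :: "real measure set" where
  "ID_Rplus = {\<mu>. infdiv \<mu> \<and> emeasure \<mu> {..<0} = 0}"

definition dlog :: "real measure \<Rightarrow> real \<Rightarrow> complex" where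
  "dlog \<mu> = (THE \<psi>. continuous_on UNIV \<psi> \<and> \<psi> 0 = 0 \<and> (\<forall>u. exp (\<psi> u) = char \<mu> u))"

definition mu_pow :: "real measure \<Rightarrow> real \<Rightarrow> real measure" where
  "mu_pow \<mu> s = (THE \<nu>. real_distribution \<nu> \<and>
      char \<nu> = (\<lambda>u. exp (complex_of_real s * dlog \<mu> u)))"

text \<open>Lambda_{mu_L}(mu_T): the law of L_{T_1}, i.e. the mixture of mu_L^s over s ~ mu_T.\<close>
definition Lambda :: "real measure \<Rightarrow> real measure \<Rightarrow> real measure" where
  "Lambda \<mu>L \<mu>T = measure_of UNIV (sets borel)
      (\<lambda>A. \<integral>\<^sup>+ s. emeasure (mu_pow \<mu>L s) A \<partial>\<mu>T)"

end

theory Submission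
  imports Defs "HOL-Complex_Analysis.Conformal_Mappings"
begin

text \<open>Let \<open>\<psi>\<close> be the continuous logarithm of the characteristic function of \<open>\<mu>\<^sub>L\<close>, so \<open>Re \<psi> \<le> 0\<close>. The law
  \<open>\<Lambda>(\<mu>)\<close> has characteristic function \<open>u \<mapsto> \<integral> exp (s \<psi>(u)) \<mu>(ds)\<close>, the Laplace transform of \<open>\<mu>\<close> on the
  curve \<open>\<psi>\<close>. This makes \<open>\<Lambda>\<close> a homomorphism, and weakly continuous by Levy's theorem.
  For injectivity: if \<open>\<psi>\<close> enters the open left half-plane, then, its range being connected, it
  accumulates at a point there, so by analytic continuation the Laplace transform of \<open>\<mu>\<close> is determined
  on the half-plane and by continuity on the imaginary axis. Otherwise \<open>\<mu>\<^sub>L\<close> has a characteristic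
  function of modulus 1 and is a point mass at some \<open>c \<noteq> 0\<close>, and \<open>\<psi>\<close> runs through the imaginary axis.
  Some point mass is never attained: the one at 1 in the first case, the one at \<open>-c\<close> in the second.\<close>

section \<open>Characteristic functions and Levy's continuity theorem\<close>

lemma real_distribution_return: "real_distribution (return borel (c::real))"
  by (simp add: real_distribution_def real_distribution_axioms_def prob_space_return)

lemma char_return: "char (return borel c) t = iexp (t * c)"
  unfolding char_def by (subst integral_return) auto

lemma real_distribution_convolution:
  assumes "real_distribution M" "real_distribution N"
  shows "real_distribution (M \<star> N)"
proof -
  interpret M: real_distribution M by fact
  interpret N: real_distribution N by fact
  interpret pair_prob_space M N ..
  show ?thesis
    unfolding convolution_def by (rule P.real_distribution_distr) measurable
qed

lemma char_convolution:
  assumes "real_distribution M" "real_distribution N"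
  shows "char (M \<star> N) t = char M t * char N t"
proof -
  interpret M: real_distribution M by fact
  interpret N: real_distribution N by fact
  interpret pair_prob_space M N ..
  have int: "integrable (M \<Otimes>\<^sub>M N) (\<lambda>p. iexp (t * fst p) * iexp (t * snd p))"
    by (rule P.integrable_const_bound[where B=1]) (auto simp: norm_mult)
  have "char (M \<star> N) t = (CLINT p|M \<Otimes>\<^sub>M N. iexp (t * fst p) * iexp (t * snd p))"
    unfolding char_def convolution_def
    by (subst integral_distr) (auto simp: exp_add[symmetric] algebra_simps split_beta)
  also have "\<dots> = (CLINT x|M. CLINT y|N. iexp (t * x) * iexp (t * y))"
    using integral_fst'[OF int] by simp
  finally show ?thesis
    by (simp add: char_def)
qed

lemma real_distribution_conv_pow:
  "real_distribution M \<Longrightarrow> real_distribution (conv_pow M n)"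
  by (induction n) (auto intro: real_distribution_return real_distribution_convolution)

lemma char_conv_pow:
  "real_distribution M \<Longrightarrow> char (conv_pow M n) t = char M t ^ n"
  by (induction n) (auto simp: char_return char_convolution real_distribution_conv_pow)

text \<open>The law of the difference of two independent copies. Its characteristic function is real
  and nonnegative, which lets moduli stand in for complex roots later on.\<close>

definition symmetrize :: "real measure \<Rightarrow> real measure" where
  "symmetrize M = convolution M (distr M borel uminus)"

lemma real_distribution_symmetrize:
  assumes "real_distribution M"
  shows "real_distribution (symmetrize M)"
proof -
  interpret M: real_distribution M by fact
  show ?thesis
    unfolding symmetrize_def
    by (intro real_distribution_convolution assms M.real_distribution_distr) simp
qed

lemma char_symmetrize:
  assumes "real_distribution M"
  shows "char (symmetrize M) t = of_real ((cmod (char M t))\<^sup>2)"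
proof -
  interpret M: real_distribution M by fact
  have "char (distr M borel uminus) t = (CLINT x|M. cnj (iexp (t * x)))"
    unfolding char_def by (subst integral_distr) (auto simp: exp_cnj)
  also have "\<dots> = cnj (char M t)"
    unfolding char_def by (rule Bochner_Integration.integral_cnj)
  finally show ?thesis
    unfolding symmetrize_def
    by (subst char_convolution[OF assms])
       (auto intro!: M.real_distribution_distr simp: complex_norm_square simp del: of_real_power)
qed

section \<open>Tightness from characteristic functions\<close>

text \<open>Averaging \<open>1 - Re (char M)\<close> over a centred normal law of scale \<open>a\<close> bounds the tails of \<open>M\<close>
  beyond \<open>1 / a\<close>; this is what turns convergence of characteristic functions into tightness.\<close>

lemma gaussian_average_char:
  assumes "real_distribution M"
  shows "(\<integral>x. 1 - exp (- (a * x)\<^sup>2 / 2) \<partial>M)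
    = (\<integral>z. 1 - Re (char M (a * z)) \<partial>std_normal_distribution)"
proof -
  interpret M: real_distribution M by fact
  interpret N: real_distribution std_normal_distribution by (rule real_dist_normal_dist)
  interpret pair_prob_space M std_normal_distribution ..
  note [measurable_cong] = N.events_eq_borel
  have int: "integrable (M \<Otimes>\<^sub>M std_normal_distribution) (\<lambda>(x, z). cos (a * z * x))"
    by (rule P.integrable_const_bound[where B=1]) (auto simp: split_beta)
  have N_cos: "(\<integral>z. cos (t * z) \<partial>std_normal_distribution) = exp (- t\<^sup>2 / 2)" for t
  proof -
    have "exp (- t\<^sup>2 / 2) = Re (char std_normal_distribution t)"
      by (simp add: char_std_normal_distribution)
    also have "\<dots> = (\<integral>z. Re (iexp (t * z)) \<partial>std_normal_distribution)"
      unfolding char_def by (intro integral_Re[symmetric] N.integrable_iexp) auto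
    finally show ?thesis by (simp add: Re_exp)
  qed
  have Re_char: "Re (char M t) = (\<integral>x. cos (t * x) \<partial>M)" for t
    unfolding char_def by (subst integral_Re[symmetric]) (auto intro!: M.integrable_iexp simp: Re_exp)
  have "(\<integral>x. exp (- (a * x)\<^sup>2 / 2) \<partial>M)
      = (\<integral>x. (\<integral>z. cos (a * z * x) \<partial>std_normal_distribution) \<partial>M)"
    using N_cos[of "a * x" for x] by (simp add: ac_simps)
  also have "\<dots> = (\<integral>z. (\<integral>x. cos (a * z * x) \<partial>M) \<partial>std_normal_distribution)"
    by (rule Fubini_integral[OF int, symmetric])
  finally have "(\<integral>x. exp (- (a * x)\<^sup>2 / 2) \<partial>M) = (\<integral>z. Re (char M (a * z)) \<partial>std_normal_distribution)"
    by (simp add: Re_char)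
  moreover have "integrable M (\<lambda>x. exp (- (a * x)\<^sup>2 / 2))"
    by (rule M.integrable_const_bound[where B=1]) auto
  moreover have "integrable std_normal_distribution (\<lambda>z. Re (char M (a * z)))"
    using order_trans[OF abs_Re_le_cmod M.cmod_char_le_1]
    by (intro N.integrable_const_bound[where B=1]) auto
  ultimately show ?thesis
    using M.prob_space N.prob_space by simp
qed

text \<open>The constant \<open>1 - exp (- 1 / 2)\<close> is the least value of
  \<open>1 - exp (- (a * x)\<^sup>2 / 2)\<close> on the tail set, where
  \<open>(a * x)\<^sup>2\<close> is at least 1; elsewhere this integrand is nonnegative.\<close>

lemma tail_le_gaussian_average:
  assumes "real_distribution M" "a > 0"
  shows "(1 - exp (- 1 / 2)) * measure M {x. 1 / a \<le> \<bar>x\<bar>}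
    \<le> (\<integral>z. 1 - Re (char M (a * z)) \<partial>std_normal_distribution)"
proof -
  interpret M: real_distribution M by fact
  let ?c = "1 - exp (- 1 / 2) :: real"
  have "(\<integral>x. ?c * indicator {x. 1 / a \<le> \<bar>x\<bar>} x \<partial>M) \<le> (\<integral>x. 1 - exp (- (a * x)\<^sup>2 / 2) \<partial>M)"
  proof (rule integral_mono)
    show "integrable M (\<lambda>x. 1 - exp (- (a * x)\<^sup>2 / 2))"
      by (rule M.integrable_const_bound[where B=1]) (auto simp: abs_if)
    show "integrable M (\<lambda>x. ?c * indicator {x. 1 / a \<le> \<bar>x\<bar>} x)"
      by (intro integrable_mult_right M.integrable_const_bound[where B=1]) auto
    fix x
    show "?c * indicator {x. 1 / a \<le> \<bar>x\<bar>} x \<le> 1 - exp (- (a * x)\<^sup>2 / 2)"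
    proof (cases "1 / a \<le> \<bar>x\<bar>")
      case True
      then have "1 \<le> \<bar>a * x\<bar>"
        using assms(2) by (simp add: field_simps abs_mult)
      then have "1 \<le> (a * x)\<^sup>2"
        using abs_le_square_iff[of 1 "a * x"] by simp
      then show ?thesis using True by simp
    qed auto
  qed
  then show ?thesis
    unfolding gaussian_average_char[OF assms(1)] by simp
qed

lemma (in real_distribution) tail_tendsto_0:
  "(\<lambda>k. measure M {x. real k \<le> \<bar>x\<bar>}) \<longlonglongrightarrow> 0"
proof -
  have "(\<lambda>k. measure M {x. real k \<le> \<bar>x\<bar>}) \<longlonglongrightarrow> measure M (\<Inter>k. {x. real k \<le> \<bar>x\<bar>})"
    by (rule finite_Lim_measure_decseq) (auto simp: decseq_def)
  also have "(\<Inter>k. {x. real k \<le> \<bar>x\<bar>}) = ({} :: real set)"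
    using reals_Archimedean2 by (fastforce simp flip: not_le)
  finally show ?thesis by simp
qed

text \<open>Only finitely many laws escape the eventual bound, and each of them has small tails on
  its own; the largest of the radii serves all laws.\<close>

lemma tightI_eventually_tail:
  assumes M: "\<And>n. real_distribution (M n)"
    and tail: "\<And>\<epsilon>. \<epsilon> > 0 \<Longrightarrow> \<exists>r. \<forall>\<^sub>F n in sequentially. measure (M n) {x. r \<le> \<bar>x\<bar>} < \<epsilon>"
  shows "tight M"
  unfolding tight_def
proof (intro conjI allI impI M)
  fix \<epsilon> :: real assume "\<epsilon> > 0"
  obtain r N where rN: "\<And>n. n \<ge> N \<Longrightarrow> measure (M n) {x. r \<le> \<bar>x\<bar>} < \<epsilon>"
    using tail[OF \<open>\<epsilon> > 0\<close>] by (auto simp: eventually_sequentially)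
  have "\<forall>\<^sub>F k in sequentially. \<forall>n\<in>{..<N}. measure (M n) {x. real k \<le> \<bar>x\<bar>} < \<epsilon>"
    using \<open>\<epsilon> > 0\<close>
    by (intro eventually_ball_finite ballI finite_lessThan
        order_tendstoD(2)[OF real_distribution.tail_tendsto_0[OF M]])
  then obtain k where k: "\<And>n. n < N \<Longrightarrow> measure (M n) {x. real k \<le> \<bar>x\<bar>} < \<epsilon>"
    by (auto simp: eventually_sequentially)
  \<comment> \<open>The 1 guarantees \<open>-b < b\<close>, which \<open>tight\<close>
    demands.\<close>
  define b where "b = max 1 (max r (real k))"
  have "1 - \<epsilon> < measure (M n) {-b<..b}" for n
  proof -
    interpret real_distribution "M n" by (rule M)
    have "measure (M n) {x. b \<le> \<bar>x\<bar>} < \<epsilon>"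
    proof (cases "n < N")
      case True
      show ?thesis
        by (rule le_less_trans[OF finite_measure_mono k[OF True]]) (auto simp: b_def)
    next
      case False
      then show ?thesis
        by (intro le_less_trans[OF finite_measure_mono rN[of n]]) (auto simp: b_def)
    qed
    moreover have "measure (M n) (UNIV - {x. b \<le> \<bar>x\<bar>}) = 1 - measure (M n) {x. b \<le> \<bar>x\<bar>}"
      using prob_compl[of "{x. b \<le> \<bar>x\<bar>}"] by simp
    moreover have "measure (M n) (UNIV - {x. b \<le> \<bar>x\<bar>}) \<le> measure (M n) {-b<..b}"
      by (rule finite_measure_mono) auto
    ultimately show ?thesis by simp
  qed
  then show "\<exists>a b. a < b \<and> (\<forall>n. 1 - \<epsilon> < measure (M n) {a<..b})"
    by (intro exI[of _ "-b"] exI[of _ b]) (auto simp: b_def)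
qed

text \<open>Unlike the library theorem \<open>levy_continuity\<close>, the limit is not assumed to be a
  characteristic function.\<close>

theorem Levy_continuity_limit:
  fixes M :: "nat \<Rightarrow> real measure" and \<phi> :: "real \<Rightarrow> complex"
  assumes M: "\<And>n. real_distribution (M n)"
    and lim: "\<And>t. (\<lambda>n. char (M n) t) \<longlonglongrightarrow> \<phi> t"
    and cont: "isCont \<phi> 0"
  obtains L where "real_distribution L" "char L = \<phi>"
proof -
  interpret M: real_distribution "M n" for n by (rule M)
  interpret N: real_distribution std_normal_distribution by (rule real_dist_normal_dist)
  note [measurable_cong] = N.events_eq_borel
  have [measurable]: "\<phi> \<in> borel_measurable borel"
    by (rule borel_measurable_LIMSEQ_metric[OF _ lim]) simp
  have bound: "\<bar>1 - Re z\<bar> \<le> 2" if "cmod z \<le> 1" for z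
    using abs_Re_le_cmod[of z] that by linarith
  have \<phi>_le: "cmod (\<phi> t) \<le> 1" for t
    by (rule LIMSEQ_le_const2[OF tendsto_norm[OF lim]]) (auto simp: M.cmod_char_le_1)
  have \<phi>_0: "\<phi> 0 = 1"
    using lim[of 0] by (simp add: M.char_zero LIMSEQ_const_iff)
  \<comment> \<open>The order of limits matters: continuity of \<phi> at 0 first fixes a small scale
    \<open>a\<close>, and only then does n tend to infinity with \<open>a\<close> held fixed. Both
    passages are dominated by the constant 2.\<close>
  have "tight M"
  proof (rule tightI_eventually_tail[OF M])
    fix \<epsilon> :: real assume "\<epsilon> > 0"
    define c where "c = 1 - exp (- 1 / 2 :: real)"
    have "c > 0" by (simp add: c_def)
    have "(\<lambda>j. \<integral>z. 1 - Re (\<phi> (1 / real (Suc j) * z)) \<partial>std_normal_distribution)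
        \<longlonglongrightarrow> (\<integral>z. 1 - Re (\<phi> 0) \<partial>std_normal_distribution)"
    proof (rule integral_dominated_convergence[where w="\<lambda>_. 2"])
      show "AE z in std_normal_distribution.
          (\<lambda>j. 1 - Re (\<phi> (1 / real (Suc j) * z))) \<longlonglongrightarrow> 1 - Re (\<phi> 0)"
      proof (intro AE_I2 tendsto_intros isCont_tendsto_compose[OF cont])
        fix z :: real
        show "(\<lambda>j. 1 / real (Suc j) * z) \<longlonglongrightarrow> 0"
          using tendsto_mult_left[OF LIMSEQ_inverse_real_of_nat, of z]
          by (simp add: field_simps)
      qed
    qed (auto intro: bound \<phi>_le)
    then have "(\<lambda>j. \<integral>z. 1 - Re (\<phi> (1 / real (Suc j) * z)) \<partial>std_normal_distribution) \<longlonglongrightarrow> 0"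
      by (simp add: \<phi>_0)
    then have "\<forall>\<^sub>F j in sequentially.
        (\<integral>z. 1 - Re (\<phi> (1 / real (Suc j) * z)) \<partial>std_normal_distribution) < c * \<epsilon>"
      using \<open>c > 0\<close> \<open>\<epsilon> > 0\<close> by (intro order_tendstoD(2)) auto
    then obtain j where j:
      "(\<integral>z. 1 - Re (\<phi> (1 / real (Suc j) * z)) \<partial>std_normal_distribution) < c * \<epsilon>"
      by (auto simp: eventually_sequentially)
    define a where "a = 1 / real (Suc j)"
    have "a > 0" by (simp add: a_def)
    have "(\<lambda>n. \<integral>z. 1 - Re (char (M n) (a * z)) \<partial>std_normal_distribution)
        \<longlonglongrightarrow> (\<integral>z. 1 - Re (\<phi> (a * z)) \<partial>std_normal_distribution)"
      by (rule integral_dominated_convergence[where w="\<lambda>_. 2"])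
         (auto intro!: bound M.cmod_char_le_1 tendsto_intros lim)
    then have "\<forall>\<^sub>F n in sequentially.
        (\<integral>z. 1 - Re (char (M n) (a * z)) \<partial>std_normal_distribution) < c * \<epsilon>"
      using j by (intro order_tendstoD(2)) (auto simp: a_def)
    then have "\<forall>\<^sub>F n in sequentially. measure (M n) {x. 1 / a \<le> \<bar>x\<bar>} < \<epsilon>"
    proof eventually_elim
      case (elim n)
      then have "c * measure (M n) {x. 1 / a \<le> \<bar>x\<bar>} < c * \<epsilon>"
        using tail_le_gaussian_average[OF M \<open>a > 0\<close>, of n] unfolding c_def by linarith
      then show ?case using \<open>c > 0\<close> by simp
    qed
    then show "\<exists>r. \<forall>\<^sub>F n in sequentially. measure (M n) {x. r \<le> \<bar>x\<bar>} < \<epsilon>" ..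
  qed
  \<comment> \<open>Tightness yields a weakly convergent subsequence; along it the characteristic
    functions tend both to \<open>char L\<close> and to \<phi>.\<close>
  then obtain r L where r: "strict_mono (r :: nat \<Rightarrow> nat)" and L: "real_distribution L"
    and conv: "weak_conv_m (M \<circ> id \<circ> r) L"
    using tight_imp_convergent_subsubsequence[OF _ strict_mono_id] by blast
  have "char L t = \<phi> t" for t
  proof (rule LIMSEQ_unique)
    show "(\<lambda>n. char ((M \<circ> id \<circ> r) n) t) \<longlonglongrightarrow> char L t"
      by (intro levy_continuity1 L conv) (simp add: M)
    show "(\<lambda>n. char ((M \<circ> id \<circ> r) n) t) \<longlonglongrightarrow> \<phi> t"
      using LIMSEQ_subseq_LIMSEQ[OF lim r] by (simp add: o_def)
  qed
  then show ?thesis using L that by blast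
qed

section \<open>Real powers of infinitely divisible laws\<close>

lemma infdivD:
  assumes "infdiv \<mu>"
  shows "real_distribution \<mu>"
    and "\<exists>\<nu>. real_distribution \<nu> \<and> conv_pow \<nu> (Suc n) = \<mu>"
  using assms by (auto simp: infdiv_def simp del: conv_pow.simps)

text \<open>With \<open>\<nu> n\<close> the roots of \<open>\<mu>\<close>, the functions \<open>\<bar>char (\<nu> n)\<bar>\<^sup>2\<close> converge to the indicator of
  \<open>{t. char \<mu> t \<noteq> 0}\<close>. As a limit of characteristic functions that is continuous at 0, the indicator is
  a characteristic function, hence continuous everywhere, hence constantly 1.\<close>

lemma infdiv_char_nonzero:
  assumes "infdiv \<mu>"
  shows "char \<mu> t \<noteq> 0"
proof -
  interpret \<mu>: real_distribution \<mu> by (rule infdivD[OF assms])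
  obtain \<nu> where \<nu>: "\<And>n. real_distribution (\<nu> n)" "\<And>n. conv_pow (\<nu> n) (Suc n) = \<mu>"
    using infdivD(2)[OF assms] by metis
  define \<phi> where "\<phi> t = (if char \<mu> t = 0 then 0 else 1 :: complex)" for t
  have lim: "(\<lambda>n. char (symmetrize (\<nu> n)) t) \<longlonglongrightarrow> \<phi> t" for t
  proof -
    have root: "char \<mu> t = char (\<nu> n) t ^ Suc n" for n
      using char_conv_pow[OF \<nu>(1), of n "Suc n" t] \<nu>(2)[of n] by simp
    then have eq: "cmod (char (\<nu> n) t) = root (Suc n) (cmod (char \<mu> t))" for n
      by (metis norm_ge_zero norm_power real_root_power_cancel zero_less_Suc)
    show ?thesis
    proof (cases "char \<mu> t = 0")
      case True
      then show ?thesis by (simp add: char_symmetrize \<nu> eq \<phi>_def)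
    next
      case False
      then have "(\<lambda>n. root (Suc n) (cmod (char \<mu> t))) \<longlonglongrightarrow> 1"
        using LIMSEQ_Suc[OF LIMSEQ_root_const[of "cmod (char \<mu> t)"]] by simp
      then have "(\<lambda>n. complex_of_real ((root (Suc n) (cmod (char \<mu> t)))\<^sup>2)) \<longlonglongrightarrow> of_real (1\<^sup>2)"
        by (intro tendsto_of_real tendsto_power)
      then show ?thesis using False by (simp add: char_symmetrize \<nu> eq \<phi>_def)
    qed
  qed
  have "\<forall>\<^sub>F t in nhds 0. char \<mu> t \<noteq> 0"
    using \<mu>.isCont_char[of 0]
    unfolding isCont_def tendsto_at_iff_tendsto_nhds
    by (intro tendsto_imp_eventually_ne[of _ 1]) (simp_all add: \<mu>.char_zero)
  then have "\<forall>\<^sub>F t in nhds 0. \<phi> t = 1"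
    by eventually_elim (simp add: \<phi>_def)
  then have "isCont \<phi> 0"
    by (subst isCont_cong[where g="\<lambda>_. 1"]) auto
  then obtain L where L: "real_distribution L" "char L = \<phi>"
    using Levy_continuity_limit[of "\<lambda>n. symmetrize (\<nu> n)" \<phi>] lim
    by (auto intro: real_distribution_symmetrize \<nu>)
  have "continuous_on UNIV \<phi>"
    using real_distribution.isCont_char[OF L(1)] by (simp add: L continuous_on_eq_continuous_at)
  moreover have "finite (range \<phi>)"
    by (rule finite_subset[of _ "{0, 1}"]) (auto simp: \<phi>_def)
  ultimately have "\<phi> constant_on UNIV"
    by (intro continuous_finite_range_constant) auto
  then have "\<phi> t = \<phi> 0"
    by (auto simp: constant_on_def)
  then show ?thesis
    by (auto simp: \<phi>_def \<mu>.char_zero split: if_splits)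
qed

section \<open>Continuous logarithms\<close>

text \<open>The difference of the two logarithms takes values in the integer multiples of 2 \<pi> i,
  whose distinct points are at least 2 \<pi> apart; a continuous function on the connected line with
  such a range is constant.\<close>

lemma continuous_exp_eq_imp_eq:
  fixes f g :: "real \<Rightarrow> complex"
  assumes cont: "continuous_on UNIV f" "continuous_on UNIV g"
    and "f 0 = g 0" and eq: "\<And>u. exp (f u) = exp (g u)"
  shows "f = g"
proof
  fix u
  have "(\<lambda>u. f u - g u) constant_on UNIV"
  proof (rule continuous_discrete_range_constant)
    show "\<exists>e>0. \<forall>y. y \<in> UNIV \<and> f y - g y \<noteq> f x - g x \<longrightarrow> e \<le> norm (f y - g y - (f x - g x))" for x
    proof (intro exI[of _ "2 * pi"] conjI allI impI)
      fix y assume ne: "y \<in> UNIV \<and> f y - g y \<noteq> f x - g x"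
      obtain m n where mn: "f x = g x + of_int (2 * m) * pi * \<i>" "f y = g y + of_int (2 * n) * pi * \<i>"
        using eq[of x] eq[of y] unfolding exp_eq by blast
      then have "f y - g y - (f x - g x) = of_int (2 * (n - m)) * pi * \<i>"
        by (simp add: algebra_simps)
      then have "norm (f y - g y - (f x - g x)) = of_int \<bar>2 * (n - m)\<bar> * pi"
        by (simp only: norm_mult norm_of_int norm_of_real norm_ii) (simp add: abs_mult)
      moreover have "n \<noteq> m" using ne mn by auto
      then have "2 \<le> \<bar>2 * (n - m)\<bar>" by presburger
      then have "(2 :: real) \<le> of_int \<bar>2 * (n - m)\<bar>" by linarith
      ultimately show "2 * pi \<le> norm (f y - g y - (f x - g x))" by simp
    qed simp
  qed (auto intro!: continuous_intros cont)
  then have "f u - g u = f 0 - g 0"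
    by (auto simp: constant_on_def)
  then show "f u = g u" using \<open>f 0 = g 0\<close> by simp
qed

text \<open>The line is contractible, so some continuous logarithm \<open>g\<close> exists;
  subtracting \<open>g 0\<close> normalises it, since \<open>exp (g 0) = 1\<close>.\<close>

lemma continuous_logarithm_real_line:
  fixes f :: "real \<Rightarrow> complex"
  assumes "continuous_on UNIV f" "\<And>u. f u \<noteq> 0" "f 0 = 1"
  obtains \<psi> where "continuous_on UNIV \<psi>" "\<psi> 0 = 0" "\<And>u. exp (\<psi> u) = f u"
proof -
  obtain g where g: "continuous_on UNIV g" "\<And>u. f u = exp (g u)"
    using continuous_logarithm_on_contractible[of UNIV f] assms by auto
  show ?thesis
  proof
    show "continuous_on UNIV (\<lambda>u. g u - g 0)" by (intro continuous_intros g)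
    show "exp (g u - g 0) = f u" for u
      using g(2)[of 0] assms(3) by (simp add: exp_diff g(2))
  qed simp
qed

lemma dlog_eqI:
  assumes "continuous_on UNIV \<psi>" "\<psi> 0 = 0" "\<And>u. exp (\<psi> u) = char \<mu> u"
  shows "dlog \<mu> = \<psi>"
  unfolding dlog_def using assms
  by (intro the_equality) (auto intro: continuous_exp_eq_imp_eq)

text \<open>Infinite divisibility rules out zeros of \<open>char \<mu>\<close>, so a normalised
  continuous logarithm exists; uniqueness identifies it with the \<open>THE\<close> in
  \<open>dlog_def\<close>.\<close>

lemma dlog_infdiv:
  assumes "infdiv \<mu>"
  shows continuous_dlog: "continuous_on UNIV (dlog \<mu>)"
    and dlog_0: "dlog \<mu> 0 = 0"
    and exp_dlog: "exp (dlog \<mu> u) = char \<mu> u"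
proof -
  interpret \<mu>: real_distribution \<mu> by (rule infdivD[OF assms])
  obtain \<psi> where "continuous_on UNIV \<psi>" "\<psi> 0 = 0" "\<And>u. exp (\<psi> u) = char \<mu> u"
    using continuous_logarithm_real_line[of "char \<mu>"] infdiv_char_nonzero[OF assms]
      \<mu>.char_zero \<mu>.isCont_char
    by (metis continuous_at_imp_continuous_on)
  moreover from this have "dlog \<mu> = \<psi>" by (rule dlog_eqI)
  ultimately show "continuous_on UNIV (dlog \<mu>)" "dlog \<mu> 0 = 0" "exp (dlog \<mu> u) = char \<mu> u"
    by auto
qed

lemma Re_dlog_le_0:
  assumes "infdiv \<mu>"
  shows "Re (dlog \<mu> u) \<le> 0"
  using real_distribution.cmod_char_le_1[OF infdivD(1)[OF assms], of u]
  by (simp flip: exp_dlog[OF assms])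

text \<open>The root \<nu> also has a zero-free characteristic function, hence its own logarithm
  \<psi>. Uniqueness settles the branch, \<open>dlog \<mu>\<close> being n + 1 times \<psi>, and the
  m-th convolution power of \<nu> is the law sought.\<close>

lemma infdiv_rational_power:
  assumes "infdiv \<mu>"
  shows "\<exists>\<nu>. real_distribution \<nu> \<and> char \<nu> = (\<lambda>u. exp (of_real (real m / real (Suc n)) * dlog \<mu> u))"
proof -
  obtain \<nu> where \<nu>: "real_distribution \<nu>" "conv_pow \<nu> (Suc n) = \<mu>"
    using infdivD(2)[OF assms] by blast
  interpret \<nu>: real_distribution \<nu> by fact
  have root: "char \<mu> t = char \<nu> t ^ Suc n" for t
    using char_conv_pow[OF \<nu>(1), of "Suc n" t] \<nu>(2) by simp
  then have "char \<nu> t \<noteq> 0" for t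
    using infdiv_char_nonzero[OF assms, of t] by auto
  then obtain \<psi> where \<psi>: "continuous_on UNIV \<psi>" "\<psi> 0 = 0" "\<And>u. exp (\<psi> u) = char \<nu> u"
    using continuous_logarithm_real_line[of "char \<nu>"] \<nu>.char_zero \<nu>.isCont_char
    by (metis continuous_at_imp_continuous_on)
  have "dlog \<mu> = (\<lambda>u. of_nat (Suc n) * \<psi> u)"
    using \<psi> by (intro dlog_eqI) (auto intro!: continuous_intros simp: root exp_of_nat_mult simp del: of_nat_Suc)
  moreover have "of_real (real m / real (Suc n)) * (of_nat (Suc n) * z) = of_nat m * z" for z :: complex
    by (simp del: of_nat_Suc)
  ultimately have "of_real (real m / real (Suc n)) * dlog \<mu> u = of_nat m * \<psi> u" for u
    by simp
  then have "char (conv_pow \<nu> m) u = exp (of_real (real m / real (Suc n)) * dlog \<mu> u)" for u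
    by (simp only: exp_of_nat_mult \<psi> char_conv_pow[OF \<nu>(1)])
  then show ?thesis
    using real_distribution_conv_pow[OF \<nu>(1)] by blast
qed

text \<open>Rational exponents approximate s, and the limit of the characteristic functions is
  continuous at 0, so Levy's theorem supplies the law.\<close>

lemma infdiv_real_power:
  assumes "infdiv \<mu>" "0 \<le> s"
  obtains \<nu> where "real_distribution \<nu>" "char \<nu> = (\<lambda>u. exp (of_real s * dlog \<mu> u))"
proof -
  \<comment> \<open>Rounding down places \<open>q n\<close> between s - 1/(n + 1) and s; since s is
    nonnegative, \<open>nat\<close> does not alter the floor.\<close>
  define q where "q n = real (nat \<lfloor>s * real (Suc n)\<rfloor>) / real (Suc n)" for n
  have "\<forall>n. \<exists>\<nu>. real_distribution \<nu> \<and> char \<nu> = (\<lambda>u. exp (of_real (q n) * dlog \<mu> u))"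
    unfolding q_def by (intro allI infdiv_rational_power assms)
  from choice[OF this] obtain \<nu> where \<nu>: "\<And>n. real_distribution (\<nu> n)"
    "\<And>n. char (\<nu> n) = (\<lambda>u. exp (of_real (q n) * dlog \<mu> u))"
    by blast
  have "q \<longlonglongrightarrow> s"
  proof (rule tendsto_sandwich)
    have fl: "real (nat \<lfloor>s * real (Suc n)\<rfloor>) = of_int \<lfloor>s * real (Suc n)\<rfloor>" for n
      using assms(2) by (intro of_nat_nat) simp
    show "\<forall>\<^sub>F n in sequentially. q n \<le> s"
      unfolding q_def fl by (intro always_eventually allI) (simp add: field_simps del: of_nat_Suc)
    show "\<forall>\<^sub>F n in sequentially. s - inverse (real (Suc n)) \<le> q n"
    proof (intro always_eventually allI)
      fix n
      have "(s * real (Suc n) - 1) / real (Suc n) \<le> of_int \<lfloor>s * real (Suc n)\<rfloor> / real (Suc n)"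
        by (intro divide_right_mono) linarith+
      then show "s - inverse (real (Suc n)) \<le> q n"
        unfolding q_def fl by (simp add: diff_divide_distrib inverse_eq_divide del: of_nat_Suc)
    qed
    show "(\<lambda>n. s - inverse (real (Suc n))) \<longlonglongrightarrow> s"
      using tendsto_diff[OF tendsto_const LIMSEQ_inverse_real_of_nat, of s] by simp
  qed simp
  then have lim: "(\<lambda>n. char (\<nu> n) u) \<longlonglongrightarrow> exp (of_real s * dlog \<mu> u)" for u
    unfolding \<nu> by (intro tendsto_intros)
  have "isCont (\<lambda>u. exp (of_real s * dlog \<mu> u)) 0"
    using continuous_dlog[OF assms(1)]
    by (intro continuous_intros) (simp add: continuous_on_eq_continuous_at)
  then show ?thesis
    using Levy_continuity_limit[OF \<nu>(1) lim] that by blast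
qed

text \<open>Existence comes from \<open>infdiv_real_power\<close> and uniqueness from Levy's
  uniqueness theorem, so the \<open>THE\<close> in \<open>mu_pow_def\<close> denotes the intended
  law.\<close>

lemma mu_pow_infdiv:
  assumes "infdiv \<mu>" "0 \<le> s"
  shows real_distribution_mu_pow: "real_distribution (mu_pow \<mu> s)"
    and char_mu_pow: "char (mu_pow \<mu> s) u = exp (of_real s * dlog \<mu> u)"
proof -
  obtain \<nu> where \<nu>: "real_distribution \<nu>" "char \<nu> = (\<lambda>u. exp (of_real s * dlog \<mu> u))"
    using infdiv_real_power[OF assms] .
  then have "mu_pow \<mu> s = \<nu>"
    unfolding mu_pow_def by (intro the_equality) (auto intro: Levy_uniqueness)
  with \<nu> show "real_distribution (mu_pow \<mu> s)"
    "char (mu_pow \<mu> s) u = exp (of_real s * dlog \<mu> u)"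
    by auto
qed

section \<open>Subordination\<close>

text \<open>For fixed u the value \<open>exp (s * dlog \<mu> u)\<close> is continuous in s, and
  pointwise convergence of characteristic functions gives weak convergence.\<close>

lemma mu_pow_weak_continuous:
  assumes "infdiv \<mu>" "X \<longlonglongrightarrow> s" "\<And>n. 0 \<le> X n"
  shows "weak_conv_m (\<lambda>n. mu_pow \<mu> (X n)) (mu_pow \<mu> s)"
proof -
  have "0 \<le> s" using assms(2,3) by (auto intro: LIMSEQ_le_const)
  then show ?thesis
    by (intro levy_continuity)
       (auto simp: mu_pow_infdiv assms intro!: tendsto_intros)
qed

text \<open>For \<open>s < 0\<close> the law \<open>mu_pow \<mu> s\<close> need not exist, and the underlying \<open>THE\<close> is then unspecified.\<close>

lemma measurable_mu_pow:
  assumes \<mu>: "infdiv \<mu>"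
  shows "(\<lambda>s. mu_pow \<mu> (max 0 s)) \<in> borel \<rightarrow>\<^sub>M subprob_algebra borel"
proof -
  define K where "K s = mu_pow \<mu> (max 0 s)" for s
  have K: "real_distribution (K s)" for s
    unfolding K_def by (rule real_distribution_mu_pow[OF \<mu>]) simp
  interpret K: real_distribution "K s" for s by (rule K)
  \<comment> \<open>Integrals of bounded continuous functions are continuous in s by weak continuity
    of the kernel, hence measurable.\<close>
  have int_meas: "(\<lambda>s. \<integral>x. f x \<partial>K s) \<in> borel_measurable borel"
    if "\<And>x. isCont f x" "\<And>x. norm (f x) \<le> 1" for f :: "real \<Rightarrow> real"
  proof (intro borel_measurable_continuous_onI continuous_at_imp_continuous_on ballI)
    show "isCont (\<lambda>s. \<integral>x. f x \<partial>K s) s" for s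
      unfolding continuous_at_sequentially
    proof safe
      fix X assume "X \<longlonglongrightarrow> s"
      then have "weak_conv_m (\<lambda>n. K (X n)) (K s)"
        unfolding K_def by (intro mu_pow_weak_continuous \<mu> tendsto_intros) auto
      then show "((\<lambda>s. \<integral>x. f x \<partial>K s) \<circ> X) \<longlonglongrightarrow> (\<integral>x. f x \<partial>K s)"
        using weak_conv_imp_integral_bdd_continuous_conv[OF K K _ that] by (simp add: o_def)
    qed
  qed
  have "K \<in> borel \<rightarrow>\<^sub>M subprob_algebra borel"
  proof (rule measurable_subprob_algebra_generated)
    show "sets borel = sigma_sets UNIV (range (atMost :: real \<Rightarrow> _))"
      by (subst borel_eq_atMost) simp
    show "Int_stable (range (atMost :: real \<Rightarrow> _))"
      by (auto simp: Int_stable_def)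
    fix A :: "real set" assume "A \<in> range atMost"
    then obtain a where A: "A = {..a}" by auto
    \<comment> \<open>The function \<open>?f m\<close> is 1 up to \<open>a\<close> and falls
      linearly to 0 over a length 1/(m + 1). These continuous functions tend to the indicator of
      \<open>{..a}\<close>, and half-lines generate the Borel sets.\<close>
    let ?f = "\<lambda>m. cts_step a (a + inverse (real (Suc m)))"
    have f_lim: "(\<lambda>m. ?f m x) \<longlonglongrightarrow> indicator A x" for x
    proof (cases "x \<le> a")
      case True
      then show ?thesis by (simp add: cts_step_def A)
    next
      case False
      then have "\<forall>\<^sub>F m in sequentially. inverse (real (Suc m)) < x - a"
        by (intro order_tendstoD(2)[OF LIMSEQ_inverse_real_of_nat]) simp
      then have "\<forall>\<^sub>F m in sequentially. ?f m x = indicator A x"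
        by eventually_elim (use False in \<open>auto simp: cts_step_def A\<close>)
      then show ?thesis by (rule tendsto_eventually)
    qed
    have f_cont: "isCont (?f m) x" for m x
      using uniformly_continuous_imp_continuous[OF cts_step_uniformly_continuous]
      by (auto simp: continuous_on_eq_continuous_at)
    have f_le: "norm (?f m x) \<le> 1" for m x
      by (auto simp: cts_step_def)
    have f_meas: "?f m \<in> borel_measurable borel" for m
      by (intro borel_measurable_continuous_onI continuous_at_imp_continuous_on ballI f_cont)
    have "(\<lambda>m. \<integral>x. ?f m x \<partial>K s) \<longlonglongrightarrow> (\<integral>x. indicator A x \<partial>K s)" for s
    proof (rule integral_dominated_convergence[where w="\<lambda>_. 1"])
      show "AE x in K s. (\<lambda>m. ?f m x) \<longlonglongrightarrow> indicator A x"
        by (rule AE_I2) (rule f_lim)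
      show "AE x in K s. norm (?f m x) \<le> 1" for m
        by (rule AE_I2) (rule f_le)
      show "indicator A \<in> borel_measurable (K s)"
        unfolding A by measurable
    qed (use f_meas in \<open>simp_all del: of_nat_Suc\<close>)
    then have "(\<lambda>m. \<integral>x. ?f m x \<partial>K s) \<longlonglongrightarrow> measure (K s) A" for s
      by (simp add: A)
    then have "(\<lambda>s. measure (K s) A) \<in> borel_measurable borel"
      by (rule borel_measurable_LIMSEQ_real) (rule int_meas[OF f_cont f_le])
    then show "(\<lambda>s. emeasure (K s) A) \<in> borel_measurable borel"
      by (simp add: K.emeasure_eq_measure)
  next
    show "(\<lambda>s. emeasure (K s) UNIV) \<in> borel_measurable borel"
      using K.emeasure_space_1 by simp
  qed (auto intro: K.subprob_space_axioms)
  then show ?thesis by (simp add: K_def[abs_def])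
qed

section \<open>Laplace transforms and the law of the subordinated process\<close>

text \<open>Support in the half-line is kept apart from infinite divisibility, so that it can be
  traced through convolutions and roots; the almost-everywhere form feeds integral congruences
  directly.\<close>

definition nonneg_distribution :: "real measure \<Rightarrow> bool" where
  "nonneg_distribution M \<longleftrightarrow> real_distribution M \<and> (AE s in M. 0 \<le> s)"

lemma nonneg_distributionD:
  assumes "nonneg_distribution M"
  shows "real_distribution M" "AE s in M. 0 \<le> s"
  using assms by (auto simp: nonneg_distribution_def)

text \<open>The truncation \<open>max 0 s\<close> changes nothing on the support of a nonnegative law, but makes the
  integrand bounded on the whole real line when \<open>Re z \<le> 0\<close>.\<close>

definition laplace :: "real measure \<Rightarrow> complex \<Rightarrow> complex" where
  "laplace M z = (CLINT s|M. exp (of_real (max 0 s) * z))"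

lemma cmod_exp_max_le_1: "Re z \<le> 0 \<Longrightarrow> cmod (exp (of_real (max 0 s) * z)) \<le> 1"
  by (simp add: mult_nonneg_nonpos max_def)

text \<open>Identifies the raw \<open>measure_of\<close> with a mixture over a measurable kernel,
  which is known to be a measure. The truncated exponent agrees with s almost everywhere, and
  \<open>measure_of\<close> depends only on values on the Borel sets.\<close>

lemma Lambda_eq_bind:
  assumes \<mu>: "infdiv \<mu>" and M: "nonneg_distribution M"
  shows "Lambda \<mu> M = M \<bind> (\<lambda>s. mu_pow \<mu> (max 0 s))" (is "_ = ?B")
proof -
  interpret M: real_distribution M by (rule nonneg_distributionD[OF M])
  have K: "(\<lambda>s. mu_pow \<mu> (max 0 s)) \<in> M \<rightarrow>\<^sub>M subprob_algebra borel"
    using measurable_mu_pow[OF \<mu>] by simp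
  have [simp]: "sets ?B = sets borel" "space ?B = UNIV"
    by (simp_all add: sets_bind[OF sets_kernel[OF K]] space_bind[OF sets_kernel[OF K]])
  have "emeasure ?B A = (\<integral>\<^sup>+ s. emeasure (mu_pow \<mu> s) A \<partial>M)" if "A \<in> sets borel" for A
  proof -
    have "emeasure ?B A = (\<integral>\<^sup>+ s. emeasure (mu_pow \<mu> (max 0 s)) A \<partial>M)"
      using K that by (intro emeasure_bind) auto
    also have "\<dots> = (\<integral>\<^sup>+ s. emeasure (mu_pow \<mu> s) A \<partial>M)"
      using nonneg_distributionD(2)[OF M]
      by (intro nn_integral_cong_AE) (auto simp: max_def elim!: eventually_mono)
    finally show ?thesis .
  qed
  then have "Lambda \<mu> M = measure_of UNIV (sets borel) (emeasure ?B)"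
    unfolding Lambda_def using sets.sigma_sets_eq[of "borel :: real measure"]
    by (intro measure_of_eq) auto
  also have "\<dots> = ?B"
    using measure_of_of_measure[of ?B] by simp
  finally show ?thesis .
qed

lemma
  assumes \<mu>: "infdiv \<mu>" and M: "nonneg_distribution M"
  shows real_distribution_Lambda: "real_distribution (Lambda \<mu> M)"
    and char_Lambda: "char (Lambda \<mu> M) u = laplace M (dlog \<mu> u)"
proof -
  interpret M: real_distribution M by (rule nonneg_distributionD[OF M])
  let ?K = "\<lambda>s. mu_pow \<mu> (max 0 s)"
  have K: "?K \<in> M \<rightarrow>\<^sub>M subprob_algebra borel"
    using measurable_mu_pow[OF \<mu>] by simp
  have K_dist: "real_distribution (?K s)" for s
    by (rule real_distribution_mu_pow[OF \<mu>]) simp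
  then have K_prob: "prob_space (?K s)" for s
    by (rule real_distribution.axioms)
  have "prob_space (M \<bind> ?K)"
    by (rule M.prob_space_bind[OF _ K]) (simp add: K_prob)
  moreover have "sets (M \<bind> ?K) = sets borel"
    by (simp add: sets_bind[OF sets_kernel[OF K]])
  ultimately show L: "real_distribution (Lambda \<mu> M)"
    by (simp add: Lambda_eq_bind[OF assms] real_distribution_def real_distribution_axioms_def)
  interpret L: real_distribution "Lambda \<mu> M" by (rule L)
  \<comment> \<open>This mixture formula is for real integrands, so the characteristic function is
    split into its cosine and sine parts and reassembled at the end.\<close>
  have bind: "(\<integral>x. f x \<partial>Lambda \<mu> M) = (\<integral>s. (\<integral>x. f x \<partial>?K s) \<partial>M)"
    if "f \<in> borel_measurable borel" "\<And>x. \<bar>f x\<bar> \<le> 1" for f :: "real \<Rightarrow> real"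
    unfolding Lambda_eq_bind[OF assms]
    by (rule integral_bind[where K=borel and B=1 and B'=1])
       (use that K K_prob in \<open>auto simp: prob_space.emeasure_space_1 M.finite_measure_axioms\<close>)
  have char_cos_sin: "char N u = Complex (\<integral>x. cos (u * x) \<partial>N) (\<integral>x. sin (u * x) \<partial>N)"
    if "real_distribution N" for N
  proof -
    interpret N: real_distribution N by fact
    have int: "integrable N (\<lambda>x. iexp (u * x))"
      by (rule N.integrable_iexp) auto
    show ?thesis
      using integral_Re[OF int] integral_Im[OF int]
      by (simp add: char_def complex_eq_iff Re_exp Im_exp)
  qed
  have int: "integrable M (\<lambda>s. exp (of_real (max 0 s) * dlog \<mu> u))"
    by (rule M.integrable_const_bound[where B=1])
       (auto simp: cmod_exp_max_le_1 Re_dlog_le_0[OF \<mu>] simp del: norm_exp_eq_Re)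
  have K_char: "exp (of_real (max 0 s) * dlog \<mu> u)
      = Complex (\<integral>x. cos (u * x) \<partial>?K s) (\<integral>x. sin (u * x) \<partial>?K s)" for s
    using char_mu_pow[OF \<mu>, of "max 0 s" u] char_cos_sin[OF K_dist, of s] by simp
  have "laplace M (dlog \<mu> u)
      = Complex (\<integral>s. (\<integral>x. cos (u * x) \<partial>?K s) \<partial>M) (\<integral>s. (\<integral>x. sin (u * x) \<partial>?K s) \<partial>M)"
    using integral_Re[OF int] integral_Im[OF int]
    unfolding laplace_def by (simp add: complex_eq_iff K_char)
  then show "char (Lambda \<mu> M) u = laplace M (dlog \<mu> u)"
    by (simp add: char_cos_sin[OF L] bind)
qed

section \<open>Homomorphism property and weak continuity\<close>

lemma nonneg_distribution_convolution:
  assumes M: "nonneg_distribution M" and N: "nonneg_distribution N"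
  shows "nonneg_distribution (M \<star> N)"
proof -
  interpret M: real_distribution M by (rule nonneg_distributionD[OF M])
  interpret N: real_distribution N by (rule nonneg_distributionD[OF N])
  interpret pair_prob_space M N ..
  have "AE p in M \<Otimes>\<^sub>M N. 0 \<le> fst p + snd p"
  proof (rule AE_pair_measure)
    show "{p \<in> space (M \<Otimes>\<^sub>M N). 0 \<le> fst p + snd p} \<in> sets (M \<Otimes>\<^sub>M N)"
      by measurable
    show "AE x in M. AE y in N. 0 \<le> fst (x, y) + snd (x, y)"
      using nonneg_distributionD(2)[OF M] nonneg_distributionD(2)[OF N]
      by (auto elim!: eventually_mono)
  qed
  then have "AE s in M \<star> N. 0 \<le> s"
    unfolding convolution_def by (subst AE_distr_iff) (auto simp: split_beta)
  then show ?thesis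
    using assms by (auto simp: nonneg_distribution_def intro: real_distribution_convolution)
qed

text \<open>After Fubini the exponential of a sum factorises. With the truncation this holds only
  for nonnegative summands, whence the two almost-everywhere congruences.\<close>

lemma laplace_convolution:
  assumes M: "nonneg_distribution M" and N: "nonneg_distribution N" and z: "Re z \<le> 0"
  shows "laplace (M \<star> N) z = laplace M z * laplace N z"
proof -
  interpret M: real_distribution M by (rule nonneg_distributionD[OF M])
  interpret N: real_distribution N by (rule nonneg_distributionD[OF N])
  interpret pair_prob_space M N ..
  let ?e = "\<lambda>s. exp (of_real (max 0 s) * z) :: complex"
  have int: "integrable (M \<Otimes>\<^sub>M N) (\<lambda>p. ?e (fst p + snd p))"
    by (rule P.integrable_const_bound[where B=1]) (auto simp: cmod_exp_max_le_1[OF z] simp del: norm_exp_eq_Re)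
  have "laplace (M \<star> N) z = (CLINT p|M \<Otimes>\<^sub>M N. ?e (fst p + snd p))"
    unfolding laplace_def convolution_def
    by (subst integral_distr) (auto simp: split_beta)
  also have "\<dots> = (CLINT x|M. CLINT y|N. ?e (x + y))"
    using integral_fst'[OF int] by simp
  also have "\<dots> = (CLINT x|M. ?e x * laplace N z)"
  proof (rule integral_cong_AE)
    show "AE x in M. (CLINT y|N. ?e (x + y)) = ?e x * laplace N z"
      using nonneg_distributionD(2)[OF M]
    proof eventually_elim
      case (elim x)
      have "(CLINT y|N. ?e (x + y)) = (CLINT y|N. ?e x * ?e y)"
        using nonneg_distributionD(2)[OF N] elim
        by (intro integral_cong_AE) (auto elim!: eventually_mono simp: exp_add[symmetric] algebra_simps)
      then show ?case by (simp add: laplace_def)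
    qed
  qed auto
  finally show ?thesis by (simp add: laplace_def)
qed

lemma Lambda_convolution:
  assumes \<mu>: "infdiv \<mu>" and M: "nonneg_distribution M" and N: "nonneg_distribution N"
  shows "Lambda \<mu> (M \<star> N) = (Lambda \<mu> M \<star> Lambda \<mu> N)"
  using assms
  by (intro Levy_uniqueness ext)
     (simp_all add: real_distribution_Lambda real_distribution_convolution char_convolution
       nonneg_distribution_convolution char_Lambda laplace_convolution Re_dlog_le_0)

text \<open>For fixed u the truncated exponential is a continuous function of s bounded by 1, so
  weak convergence carries over to the Laplace transforms, which are the characteristic functions of
  the images.\<close>

lemma weak_conv_Lambda:
  assumes \<mu>: "infdiv \<mu>" and Ms: "\<And>n. nonneg_distribution (Ms n)" and M: "nonneg_distribution M"
    and conv: "weak_conv_m Ms M"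
  shows "weak_conv_m (\<lambda>n. Lambda \<mu> (Ms n)) (Lambda \<mu> M)"
proof (rule levy_continuity)
  show "(\<lambda>n. char (Lambda \<mu> (Ms n)) u) \<longlonglongrightarrow> char (Lambda \<mu> M) u" for u
    unfolding char_Lambda[OF \<mu> Ms] char_Lambda[OF \<mu> M] laplace_def
    by (rule weak_conv_imp_integral_bdd_continuous_conv[where B=1, OF nonneg_distributionD(1)[OF Ms]
          nonneg_distributionD(1)[OF M] conv])
       (intro continuous_intros cmod_exp_max_le_1 Re_dlog_le_0[OF \<mu>])+
qed (use assms in \<open>auto intro: real_distribution_Lambda\<close>)

section \<open>Infinite divisibility of the image\<close>

lemma convolution_return_0:
  assumes "real_distribution M"
  shows "(M \<star> return borel 0) = M"
  using assms
  by (intro Levy_uniqueness ext)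
     (simp_all add: real_distribution_convolution real_distribution_return char_convolution char_return)

text \<open>Nonnegativity of the powers is carried along because the induction step applies
  \<open>Lambda_convolution\<close> to them.\<close>

lemma conv_pow_Lambda:
  assumes \<mu>: "infdiv \<mu>" and M: "nonneg_distribution M"
  shows "conv_pow (Lambda \<mu> M) (Suc n) = Lambda \<mu> (conv_pow M (Suc n))
    \<and> nonneg_distribution (conv_pow M (Suc n))"
proof (induction n)
  case 0
  show ?case
    using assms by (simp add: convolution_return_0 real_distribution_Lambda nonneg_distributionD)
next
  case (Suc n)
  then show ?case
    using assms by (simp add: Lambda_convolution nonneg_distribution_convolution del: conv_pow.simps(2)
        add: conv_pow.simps(2)[of _ "Suc n"])
qed

text \<open>Two negative independent summands have a negative sum.\<close>

lemma convolution_lessThan_0_ge: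
  assumes "real_distribution M" "real_distribution N"
  shows "emeasure M {..<0} * emeasure N {..<0} \<le> emeasure (M \<star> N) {..<0}"
proof -
  interpret M: real_distribution M by fact
  interpret N: real_distribution N by fact
  interpret pair_prob_space M N ..
  have "emeasure M {..<0} * emeasure N {..<0} = emeasure (M \<Otimes>\<^sub>M N) ({..<0} \<times> {..<0})"
    by (rule N.emeasure_pair_measure_Times[symmetric]) auto
  also have "\<dots> \<le> emeasure (M \<Otimes>\<^sub>M N) ((\<lambda>(x, y). x + y) -` {..<0} \<inter> space (M \<Otimes>\<^sub>M N))"
    by (rule emeasure_mono[OF _ measurable_sets[of _ _ borel]]) (auto simp: space_pair_measure)
  also have "\<dots> = emeasure (M \<star> N) {..<0}"
    unfolding convolution_def by (rule emeasure_distr[symmetric]) auto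
  finally show ?thesis .
qed

lemma nonneg_distribution_iff:
  "nonneg_distribution M \<longleftrightarrow> real_distribution M \<and> emeasure M {..<0} = 0"
proof (cases "real_distribution M")
  case True
  then interpret real_distribution M .
  have "(AE s in M. 0 \<le> s) \<longleftrightarrow> emeasure M {..<0} = 0"
    by (rule AE_iff_measurable) auto
  then show ?thesis
    using True by (simp add: nonneg_distribution_def)
qed (simp add: nonneg_distribution_def)

lemma ID_Rplus_iff: "M \<in> ID_Rplus \<longleftrightarrow> infdiv M \<and> nonneg_distribution M"
  by (auto simp: ID_Rplus_def nonneg_distribution_iff infdivD)

text \<open>If M charged the negative half-line, then so would each of its positive convolution
  powers.\<close>

lemma nonneg_distribution_root:
  assumes M: "real_distribution M" and pow: "nonneg_distribution (conv_pow M (Suc n))"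
  shows "nonneg_distribution M"
proof (rule ccontr)
  assume "\<not> nonneg_distribution M"
  then have pos: "0 < emeasure M {..<0}"
    using M by (simp add: nonneg_distribution_iff zero_less_iff_neq_zero)
  have "0 < emeasure (conv_pow M (Suc n)) {..<0}"
  proof (induction n)
    case 0
    then show ?case using pos by (simp add: convolution_return_0 M)
  next
    case (Suc n)
    have "0 < emeasure M {..<0} * emeasure (conv_pow M (Suc n)) {..<0}"
      using Suc pos by (simp add: ennreal_zero_less_mult_iff)
    also have "\<dots> \<le> emeasure (conv_pow M (Suc (Suc n))) {..<0}"
      unfolding conv_pow.simps(2)[of _ "Suc n"]
      by (intro convolution_lessThan_0_ge M real_distribution_conv_pow)
    finally show ?case .
  qed
  then show False
    using pow by (simp add: nonneg_distribution_iff)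
qed

text \<open>A convolution root of M lives on the half-line too, so its image under
  \<open>Lambda \<mu>\<close> makes sense and, by the homomorphism property, is a root of the image
  of M.\<close>

lemma infdiv_Lambda:
  assumes \<mu>: "infdiv \<mu>" and M: "infdiv M" "nonneg_distribution M"
  shows "infdiv (Lambda \<mu> M)"
  unfolding infdiv_def
proof (intro conjI allI impI real_distribution_Lambda \<mu> M)
  fix n :: nat assume "1 \<le> n"
  then obtain k where k: "n = Suc k" by (cases n) auto
  obtain \<nu> where \<nu>: "real_distribution \<nu>" "conv_pow \<nu> (Suc k) = M"
    using infdivD(2)[OF M(1)] by blast
  then have "nonneg_distribution \<nu>"
    using nonneg_distribution_root M(2) by blast
  then have "conv_pow (Lambda \<mu> \<nu>) n = Lambda \<mu> M" "real_distribution (Lambda \<mu> \<nu>)"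
    using conv_pow_Lambda[OF \<mu>, of \<nu> k] \<nu> real_distribution_Lambda[OF \<mu>] by (auto simp: k)
  then show "\<exists>\<nu>. real_distribution \<nu> \<and> conv_pow \<nu> n = Lambda \<mu> M" by blast
qed

section \<open>Uniqueness of Laplace transforms and injectivity\<close>

lemma laplace_imaginary:
  assumes "nonneg_distribution M"
  shows "laplace M (\<i> * of_real u) = char M u"
proof -
  interpret real_distribution M by (rule nonneg_distributionD[OF assms])
  show ?thesis
    unfolding laplace_def char_def using nonneg_distributionD(2)[OF assms]
    by (intro integral_cong_AE) (auto elim!: eventually_mono simp: max_def algebra_simps)
qed

text \<open>Dominated convergence with bound 1 works up to the imaginary axis, so boundary values
  are limits from inside the half-plane.\<close>

lemma laplace_tendsto:
  assumes M: "real_distribution M" and Z: "Z \<longlonglongrightarrow> z" "\<And>n. Re (Z n) \<le> 0"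
  shows "(\<lambda>n. laplace M (Z n)) \<longlonglongrightarrow> laplace M z"
proof -
  interpret real_distribution M by fact
  show ?thesis
    unfolding laplace_def
  proof (rule integral_dominated_convergence[where w="\<lambda>_. 1"])
    show "AE s in M. (\<lambda>n. exp (of_real (max 0 s) * Z n)) \<longlonglongrightarrow> exp (of_real (max 0 s) * z)"
      by (intro AE_I2 tendsto_intros Z)
    show "AE s in M. cmod (exp (of_real (max 0 s) * Z n)) \<le> 1" for n
      by (intro AE_I2 cmod_exp_max_le_1 Z)
  qed auto
qed

text \<open>Differentiation under the integral sign: near z the difference quotients of the
  integrand are bounded uniformly in s.\<close>

lemma laplace_holomorphic:
  assumes "real_distribution M"
  shows "laplace M holomorphic_on {z. Re z < 0}"
proof (subst holomorphic_on_open)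
  interpret real_distribution M by fact
  show "open {z. Re z < 0}"
    by (rule open_halfspace_Re_lt)
  show "\<forall>z\<in>{z. Re z < 0}. \<exists>D. (laplace M has_field_derivative D) (at z)"
  proof safe
    fix z assume z: "Re z < 0"
    \<comment> \<open>Half the distance from z to the imaginary axis, so that the real part stays
      below -\<delta> on the ball of radius \<delta>.\<close>
    define \<delta> where "\<delta> = - Re z / 2"
    have "\<delta> > 0" using z by (simp add: \<delta>_def)
    let ?e = "\<lambda>s w. exp (complex_of_real (max 0 s) * w)"
    have Re_ball: "Re w \<le> - \<delta>" if "w \<in> ball z \<delta>" for w
      using that abs_Re_le_cmod[of "w - z"] by (simp add: dist_norm norm_minus_commute \<delta>_def)
    have bound: "cmod (of_real t * exp (of_real t * w)) \<le> 1 / \<delta>"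
      if "w \<in> ball z \<delta>" "0 \<le> t" for t w
    proof -
      have "t * exp (t * Re w) \<le> t * exp (- (t * \<delta>))"
        using mult_left_mono[OF Re_ball[OF that(1)] that(2)] that(2) by (intro mult_left_mono) auto
      also have "\<dots> \<le> 1 / \<delta>"
      proof -
        have "t * \<delta> \<le> exp (t * \<delta>)"
          using exp_ge_add_one_self[of "t * \<delta>"] by linarith
        then show ?thesis
          using \<open>\<delta> > 0\<close> by (simp add: exp_minus field_simps)
      qed
      finally show ?thesis using that(2) by (simp add: norm_mult)
    qed
    \<comment> \<open>The mean value inequality on the convex ball turns the derivative bound into a
      dominating constant for the difference quotients.\<close>
    have lipschitz: "cmod (?e s w - ?e s z) \<le> 1 / \<delta> * cmod (w - z)" if "w \<in> ball z \<delta>" for s w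
      by (rule field_differentiable_bound[where S="ball z \<delta>" and f'="\<lambda>w. of_real (max 0 s) * ?e s w"])
         (use that \<open>\<delta> > 0\<close> bound in \<open>auto intro!: derivative_eq_intros\<close>)
    have int: "integrable M (\<lambda>s. ?e s w)" if "w \<in> ball z \<delta>" for w
    proof (rule integrable_const_bound)
      show "AE s in M. cmod (?e s w) \<le> 1"
        using Re_ball[OF that] \<open>\<delta> > 0\<close> by (intro AE_I2 cmod_exp_max_le_1) simp
    qed simp
    have "(laplace M has_field_derivative (CLINT s|M. of_real (max 0 s) * ?e s z)) (at z within ball z \<delta>)"
      unfolding has_field_derivative_iff tendsto_at_iff_sequentially
    proof (intro allI impI)
      fix X assume X: "\<forall>i. X i \<in> ball z \<delta> - {z}" "X \<longlonglongrightarrow> z"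
      have "(\<lambda>i. CLINT s|M. (?e s (X i) - ?e s z) / (X i - z))
          \<longlonglongrightarrow> (CLINT s|M. of_real (max 0 s) * ?e s z)"
      proof (rule integral_dominated_convergence[where w="\<lambda>_. 1 / \<delta>"])
        show "AE s in M. (\<lambda>i. (?e s (X i) - ?e s z) / (X i - z)) \<longlonglongrightarrow> of_real (max 0 s) * ?e s z"
        proof (rule AE_I2)
          fix s
          have "(?e s has_field_derivative of_real (max 0 s) * ?e s z) (at z within ball z \<delta>)"
            by (auto intro!: derivative_eq_intros)
          then show "(\<lambda>i. (?e s (X i) - ?e s z) / (X i - z)) \<longlonglongrightarrow> of_real (max 0 s) * ?e s z"
            unfolding has_field_derivative_iff tendsto_at_iff_sequentially
            using X by (auto simp: o_def)
        qed
        show "AE s in M. cmod ((?e s (X i) - ?e s z) / (X i - z)) \<le> 1 / \<delta>" for i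
          using lipschitz[of "X i"] X(1) \<open>\<delta> > 0\<close>
          by (intro AE_I2) (auto simp: norm_divide divide_simps)
      qed auto
      moreover have "(CLINT s|M. (?e s (X i) - ?e s z) / (X i - z))
          = (laplace M (X i) - laplace M z) / (X i - z)" for i
        using X(1) \<open>\<delta> > 0\<close> int[of "X i"] int[of z] by (simp add: laplace_def)
      ultimately show "((\<lambda>y. (laplace M y - laplace M z) / (y - z)) \<circ> X)
          \<longlonglongrightarrow> (CLINT s|M. of_real (max 0 s) * ?e s z)"
        by (simp only: o_def)
    qed
    then have "(laplace M has_field_derivative (CLINT s|M. of_real (max 0 s) * ?e s z)) (at z)"
      using \<open>\<delta> > 0\<close> by (simp add: at_within_open[of z "ball z \<delta>"])
    then show "\<exists>D. (laplace M has_field_derivative D) (at z)" ..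
  qed
qed

lemma laplace_unique:
  assumes M: "nonneg_distribution M" and N: "nonneg_distribution N"
    and U: "U \<subseteq> {z. Re z < 0}" "\<xi> islimpt U" "Re \<xi> < 0"
    and eq: "\<And>z. z \<in> U \<Longrightarrow> laplace M z = laplace N z"
  shows "M = N"
proof (rule Levy_uniqueness)
  note MN = nonneg_distributionD(1)[OF M] nonneg_distributionD(1)[OF N]
  show "real_distribution M" "real_distribution N" by (fact MN)+
  have left: "laplace M w = laplace N w" if "Re w < 0" for w
  proof -
    have "laplace M w - laplace N w = 0"
    proof (rule analytic_continuation[where f="\<lambda>z. laplace M z - laplace N z"
          and S="{z. Re z < 0}" and U=U and \<xi>=\<xi>])
      show "(\<lambda>z. laplace M z - laplace N z) holomorphic_on {z. Re z < 0}"
        by (intro holomorphic_intros laplace_holomorphic MN)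
      show "connected {z. Re z < 0}"
        by (intro convex_connected convex_halfspace_Re_lt)
    qed (use U eq that in \<open>auto intro: open_halfspace_Re_lt\<close>)
    then show ?thesis by simp
  qed
  show "char M = char N"
  proof
    fix u
    \<comment> \<open>Points of the open half-plane approaching the imaginary axis horizontally;
      they transfer equality to the boundary, where the transforms are characteristic
      functions.\<close>
    define Z where "Z n = \<i> * of_real u - of_real (inverse (real (Suc n)))" for n
    have "Z \<longlonglongrightarrow> \<i> * of_real u - of_real 0"
      unfolding Z_def by (intro tendsto_intros LIMSEQ_inverse_real_of_nat)
    then have Z: "Z \<longlonglongrightarrow> \<i> * of_real u" "\<And>n. Re (Z n) < 0"
      by (simp_all add: Z_def)
    have "laplace M (\<i> * of_real u) = laplace N (\<i> * of_real u)"
    proof (rule LIMSEQ_unique)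
      show "(\<lambda>n. laplace M (Z n)) \<longlonglongrightarrow> laplace M (\<i> * of_real u)"
        using Z by (intro laplace_tendsto MN less_imp_le)
      show "(\<lambda>n. laplace M (Z n)) \<longlonglongrightarrow> laplace N (\<i> * of_real u)"
        unfolding left[OF Z(2)] using Z by (intro laplace_tendsto MN less_imp_le)
    qed
    then show "char M u = char N u"
      by (simp add: laplace_imaginary M N)
  qed
qed

section \<open>Degenerate laws\<close>

text \<open>The symmetrization has characteristic function 1, so two independent copies agree almost
  surely; freezing one of them shows that the other is constant.\<close>

lemma cmod_char_1_imp_return:
  assumes M: "real_distribution M" and char: "\<And>u. cmod (char M u) = 1"
  obtains c where "M = return borel c"
proof -
  let ?R = "distr M borel uminus"
  interpret M: real_distribution M by fact
  interpret R: real_distribution ?R by (rule M.real_distribution_distr) simp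
  interpret pair_prob_space M ?R ..
  have "symmetrize M = return borel 0"
    by (intro Levy_uniqueness ext)
       (simp_all add: M real_distribution_symmetrize real_distribution_return char_symmetrize char
         char_return)
  moreover have "AE z in return borel 0. z = (0 :: real)"
    by (subst AE_return) auto
  ultimately have "AE z in M \<star> ?R. z = 0"
    by (simp only: symmetrize_def)
  then have "AE p in M \<Otimes>\<^sub>M ?R. fst p + snd p = 0"
    unfolding convolution_def by (subst (asm) AE_distr_iff) (auto simp: split_beta)
  then have "AE x in M. AE y in ?R. x + y = 0"
    by (drule_tac AE_pair) simp
  \<comment> \<open>A property that holds almost everywhere for a probability measure holds at some
    point.\<close>
  then have "\<exists>x. AE y in ?R. x + y = 0"
    by (rule eventually_happens'[rotated]) (simp add: M.ae_filter_bot)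
  then obtain x where "AE y in M. x - y = 0"
    by (subst (asm) AE_distr_iff) auto
  then have AE: "AE y in M. y = x"
    by (auto elim!: eventually_mono)
  have "char M u = char (return borel x) u" for u
  proof -
    have "char M u = (CLINT y|M. iexp (u * x))"
      unfolding char_def using AE by (intro integral_cong_AE) (auto elim!: eventually_mono)
    then show ?thesis
      using M.prob_space by (simp add: char_return)
  qed
  then have "M = return borel x"
    by (intro Levy_uniqueness M real_distribution_return ext)
  then show ?thesis by (rule that)
qed

lemma infdiv_Re_dlog_0_imp_return:
  assumes \<mu>: "infdiv \<mu>" and Re: "\<And>u. Re (dlog \<mu> u) = 0"
  obtains c where "\<mu> = return borel c" "\<And>u. dlog \<mu> u = \<i> * of_real (c * u)"
proof -
  have "cmod (char \<mu> u) = 1" for u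
    using Re[of u] by (simp flip: exp_dlog[OF \<mu>])
  then obtain c where c: "\<mu> = return borel c"
    using cmod_char_1_imp_return infdivD(1)[OF \<mu>] by blast
  have "dlog \<mu> = (\<lambda>u. \<i> * of_real (c * u))"
    by (rule dlog_eqI) (auto intro!: continuous_intros simp: c char_return algebra_simps)
  with c show ?thesis using that by simp
qed

lemma infdiv_return: "infdiv (return borel c)"
  unfolding infdiv_def
proof (intro conjI allI impI real_distribution_return)
  fix n :: nat assume n: "1 \<le> n"
  have "conv_pow (return borel (c / real n)) n = return borel c"
    using n
    by (intro Levy_uniqueness ext real_distribution_conv_pow real_distribution_return)
       (simp add: char_conv_pow real_distribution_return char_return flip: exp_of_nat_mult)
  then show "\<exists>\<nu>. real_distribution \<nu> \<and> conv_pow \<nu> n = return borel c"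
    using real_distribution_return by blast
qed

section \<open>Injectivity and failure of surjectivity\<close>

lemma inj_on_Lambda:
  assumes \<mu>: "infdiv \<mu>" "\<mu> \<noteq> return borel 0"
  shows "inj_on (Lambda \<mu>) {M. nonneg_distribution M}"
proof (rule inj_onI, clarify)
  fix M N assume M: "nonneg_distribution M" and N: "nonneg_distribution N"
    and "Lambda \<mu> M = Lambda \<mu> N"
  then have eq: "laplace M (dlog \<mu> u) = laplace N (dlog \<mu> u)" for u
    by (simp flip: char_Lambda[OF \<mu>(1)])
  show "M = N"
  proof (cases "\<forall>u. Re (dlog \<mu> u) = 0")
    case True
    then obtain c where c: "\<mu> = return borel c" "\<And>u. dlog \<mu> u = \<i> * of_real (c * u)"
      using infdiv_Re_dlog_0_imp_return[OF \<mu>(1)] by metis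
    then have "c \<noteq> 0" using \<mu>(2) by auto
    \<comment> \<open>At \<open>u / c\<close> the logarithm equals i u, where the Laplace transform
      is the characteristic function at u.\<close>
    then have "char M u = char N u" for u
      using eq[of "u / c"] by (simp add: c(2) laplace_imaginary M N del: of_real_mult)
    then show ?thesis
      by (intro Levy_uniqueness ext nonneg_distributionD(1) M N)
  next
    case False
    then obtain u where u: "Re (dlog \<mu> u) < 0"
      using Re_dlog_le_0[OF \<mu>(1)] by (metis order_le_less)
    \<comment> \<open>The range is connected and contains both 0 and a point with negative real
      part, so it has no isolated points. Restricting to the open half-plane keeps the
      accumulation.\<close>
    have "dlog \<mu> u islimpt range (dlog \<mu>)"
    proof (rule connected_imp_perfect)
      show "connected (range (dlog \<mu>))"
        by (intro connected_continuous_image continuous_dlog \<mu>) auto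
      show "range (dlog \<mu>) \<noteq> {x}" for x
        using u dlog_0[OF \<mu>(1)] by (metis less_irrefl rangeI singletonD zero_complex.simps(1))
    qed simp
    moreover have "\<forall>\<^sub>F z in at (dlog \<mu> u). z \<in> {z. Re z < 0}"
      using u by (intro eventually_at_in_open' open_halfspace_Re_lt) simp
    ultimately have "dlog \<mu> u islimpt (range (dlog \<mu>) \<inter> {z. Re z < 0})"
      by (rule islimpt_Int_eventually)
    then show ?thesis
      by (rule laplace_unique[OF M N _ _ u, rotated]) (use eq in auto)
  qed
qed

lemma Lambda_not_surj:
  assumes \<mu>: "infdiv \<mu>" "\<mu> \<noteq> return borel 0"
  shows "\<exists>c. \<forall>M. nonneg_distribution M \<longrightarrow> Lambda \<mu> M \<noteq> return borel c"
proof (cases "\<forall>u. Re (dlog \<mu> u) = 0")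
  case True
  then obtain c where c: "\<mu> = return borel c" "\<And>u. dlog \<mu> u = \<i> * of_real (c * u)"
    using infdiv_Re_dlog_0_imp_return[OF \<mu>(1)] by metis
  then have "c \<noteq> 0" using \<mu>(2) by auto
  \<comment> \<open>Here \<open>Lambda \<mu>\<close> rescales by c, so reaching the mass at -c would
    force M to be the point mass at -1.\<close>
  have "Lambda \<mu> M \<noteq> return borel (- c)" if M: "nonneg_distribution M" for M
  proof
    assume "Lambda \<mu> M = return borel (- c)"
    then have "char M u = char (return borel (- 1)) u" for u
      using char_Lambda[OF \<mu>(1) M, of "u / c"] \<open>c \<noteq> 0\<close>
      by (simp add: c(2) laplace_imaginary[OF M] char_return del: of_real_mult)
    then have M_eq: "M = return borel (- 1)"
      by (intro Levy_uniqueness ext nonneg_distributionD(1) M real_distribution_return)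
    show False
      using nonneg_distributionD(2)[OF M] unfolding M_eq
      by (subst (asm) AE_return) auto
  qed
  then show ?thesis by blast
next
  case False
  then obtain u where u: "Re (dlog \<mu> u) < 0"
    using Re_dlog_le_0[OF \<mu>(1)] by (metis order_le_less)
  have "Lambda \<mu> M \<noteq> return borel 1" if M: "nonneg_distribution M" for M
  proof
    assume L: "Lambda \<mu> M = return borel 1"
    interpret M: real_distribution M by (rule nonneg_distributionD[OF M])
    \<comment> \<open>The modulus of the integrand, which is at most 1. Attaining modulus 1 at u
      forces its mean to be 1, so \<open>?r s = 1\<close> almost everywhere and M sits at 0.\<close>
    let ?r = "\<lambda>s. exp (max 0 s * Re (dlog \<mu> u))"
    have r: "0 \<le> 1 - ?r s" for s
      using u by (simp add: mult_nonneg_nonpos)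
    have int: "integrable M ?r"
      using r by (intro M.integrable_const_bound[where B=1]) auto
    have "1 = cmod (char (return borel 1) u)"
      by (simp add: char_return)
    also have "\<dots> = cmod (laplace M (dlog \<mu> u))"
      by (simp only: char_Lambda[OF \<mu>(1) M] flip: L)
    also have "\<dots> \<le> (\<integral>s. cmod (exp (of_real (max 0 s) * dlog \<mu> u)) \<partial>M)"
      unfolding laplace_def by (rule integral_norm_bound)
    also have "\<dots> = (\<integral>s. ?r s \<partial>M)"
      by simp
    finally have "(\<integral>s. 1 - ?r s \<partial>M) \<le> 0"
      using M.prob_space int by simp
    moreover have "0 \<le> (\<integral>s. 1 - ?r s \<partial>M)"
      by (intro integral_nonneg_AE AE_I2 r)
    ultimately have "AE s in M. 1 - ?r s = 0"
      using int r by (subst integral_nonneg_eq_0_iff_AE[symmetric]) auto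
    then have AE: "AE s in M. max 0 s = 0"
      using u by (auto elim!: eventually_mono)
    have "laplace M z = 1" for z
    proof -
      have "laplace M z = (CLINT s|M. 1)"
        unfolding laplace_def using AE by (intro integral_cong_AE) (auto elim!: eventually_mono)
      then show ?thesis using M.prob_space by simp
    qed
    \<comment> \<open>With M concentrated at 0 the image has characteristic function 1, but that of
      the point mass at 1 equals -1 at \<pi>.\<close>
    then have "char (return borel 1) pi = 1"
      using char_Lambda[OF \<mu>(1) M, of pi] L by simp
    then show False by (simp add: char_return)
  qed
  then show ?thesis by blast
qed

theorem theorem4p1:
  fixes \<mu>L :: "real measure"
  assumes "\<mu>L \<in> ID_R"
    and "\<mu>L \<noteq> return borel 0"
  shows "inj_on (Lambda \<mu>L) ID_Rplus
    \<and> (\<forall>\<mu>s \<mu>. (\<forall>n. \<mu>s n \<in> ID_Rplus) \<longrightarrow> \<mu> \<in> ID_Rplus \<longrightarrow> weak_conv_m \<mu>s \<mu> \<longrightarrow>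
           weak_conv_m (\<lambda>n. Lambda \<mu>L (\<mu>s n)) (Lambda \<mu>L \<mu>))
    \<and> (\<forall>\<mu>1\<in>ID_Rplus. \<forall>\<mu>2\<in>ID_Rplus.
           Lambda \<mu>L (convolution \<mu>1 \<mu>2) = convolution (Lambda \<mu>L \<mu>1) (Lambda \<mu>L \<mu>2))
    \<and> Lambda \<mu>L ` ID_Rplus \<subset> ID_R"
proof (intro conjI allI impI ballI psubsetI)
  have \<mu>L: "infdiv \<mu>L" using assms(1) by (simp add: ID_R_def)
  show "inj_on (Lambda \<mu>L) ID_Rplus"
    using inj_on_Lambda[OF \<mu>L assms(2)] by (rule inj_on_subset) (auto simp: ID_Rplus_iff)
  show "weak_conv_m (\<lambda>n. Lambda \<mu>L (\<mu>s n)) (Lambda \<mu>L \<mu>)"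
    if "\<forall>n. \<mu>s n \<in> ID_Rplus" "\<mu> \<in> ID_Rplus" "weak_conv_m \<mu>s \<mu>" for \<mu>s \<mu>
    using that by (intro weak_conv_Lambda \<mu>L) (auto simp: ID_Rplus_iff)
  show "Lambda \<mu>L (convolution \<mu>1 \<mu>2) = convolution (Lambda \<mu>L \<mu>1) (Lambda \<mu>L \<mu>2)"
    if "\<mu>1 \<in> ID_Rplus" "\<mu>2 \<in> ID_Rplus" for \<mu>1 \<mu>2
    using that by (intro Lambda_convolution \<mu>L) (auto simp: ID_Rplus_iff)
  show "Lambda \<mu>L ` ID_Rplus \<subseteq> ID_R"
    using infdiv_Lambda[OF \<mu>L] by (auto simp: ID_Rplus_iff ID_R_def)
  obtain c where "\<And>M. nonneg_distribution M \<Longrightarrow> Lambda \<mu>L M \<noteq> return borel c"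
    using Lambda_not_surj[OF \<mu>L assms(2)] by blast
  then have "return borel c \<notin> Lambda \<mu>L ` ID_Rplus"
    by (metis ID_Rplus_iff imageE)
  moreover have "return borel c \<in> ID_R"
    by (simp add: ID_R_def infdiv_return)
  ultimately show "Lambda \<mu>L ` ID_Rplus \<noteq> ID_R" by blast
qed

end
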